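(* Let $G$ be a compact topological group. Then for every closed subgroup $P$ of $\mathrm{Aut}(G)$ the topological semidirect product $G\leftthreetimes P$ is a minimal topological group.
   Context: All topological groups are Hausdorff. $\mathrm{Aut}(G)$ is the group of all topological automorphisms of $G$, equipped with the compact-open topology, which makes it a topological group. For a subgroup $P\leq \mathrm{Aut}(G)$ (with the subspace topology), $G\leftthreetimes P$ denotes the set $G\times P$ with the product topology and the multiplication $(x,f)(y,g)=(x\cdot f(y),\, f\circ g)$. A Hausdorff topological group is minimal if it does not admit a strictly coarser Hausdorff group topology. *)

theory Defs
  imports "HOL-Analysis.Analysis" "HOL-Algebra.Bij"
begin

locale topological_group = group G for G :: "('a, 'b) monoid_scheme" (structure) +
  fixes T :: "'a topology"
  assumes topspace_eq_carrier: "topspace T = carrier G"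
    and continuous_mult: "continuous_map (prod_topology T T) T (\<lambda>(x, y). x \<otimes> y)"
    and continuous_inv: "continuous_map T T (\<lambda>x. inv x)"

locale hausdorff_topological_group = topological_group +
  assumes hausdorff: "Hausdorff_space T"

definition strictly_coarser :: "'a topology \<Rightarrow> 'a topology \<Rightarrow> bool" where
  "strictly_coarser S T \<longleftrightarrow> (\<forall>U. openin S U \<longrightarrow> openin T U) \<and> S \<noteq> T"

definition minimal_topological_group ::
    "('a, 'b) monoid_scheme \<Rightarrow> 'a topology \<Rightarrow> bool" where
  "minimal_topological_group G T \<longleftrightarrow>
     hausdorff_topological_group G T \<and>
     \<not> (\<exists>S. hausdorff_topological_group G S \<and> strictly_coarser S T)"

text \<open>
  A continuous map is represented by its extensional version, so that distinct functions in
  the space below differ at some point of \<^term>\<open>topspace X\<close>.  The case \<open>K = {}\<close> of the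
  subbasis makes the generated topology have all of the continuous maps as its points.
\<close>

definition compact_open_topology ::
    "'a topology \<Rightarrow> 'b topology \<Rightarrow> ('a \<Rightarrow> 'b) topology" where
  "compact_open_topology X Y = topology_generated_by
     {{f \<in> extensional (topspace X). continuous_map X Y f \<and> f ` K \<subseteq> U} | K U.
        compactin X K \<and> openin Y U}"

definition top_auto_group ::
    "('a, 'b) monoid_scheme \<Rightarrow> 'a topology \<Rightarrow> ('a \<Rightarrow> 'a) monoid" where
  "top_auto_group G T = AutoGroup G \<lparr>carrier := {f \<in> auto G. homeomorphic_map T T f}\<rparr>"

definition top_auto_topology ::
    "('a, 'b) monoid_scheme \<Rightarrow> 'a topology \<Rightarrow> ('a \<Rightarrow> 'a) topology" where
  "top_auto_topology G T =
     subtopology (compact_open_topology T T) (carrier (top_auto_group G T))"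

text \<open>
  The product \<open>f \<otimes> g\<close> in \<^const>\<open>AutoGroup\<close> is the composition \<open>f \<circ> g\<close>,
  restricted to the carrier of \<open>G\<close>.
\<close>

definition semidirect_product ::
    "('a, 'b) monoid_scheme \<Rightarrow> ('a \<Rightarrow> 'a) set \<Rightarrow> ('a \<times> ('a \<Rightarrow> 'a)) monoid" where
  "semidirect_product G P =
     \<lparr>carrier = carrier G \<times> P,
      mult = (\<lambda>(x, f) (y, g). (x \<otimes>\<^bsub>G\<^esub> f y, f \<otimes>\<^bsub>AutoGroup G\<^esub> g)),
      one = (\<one>\<^bsub>G\<^esub>, \<one>\<^bsub>AutoGroup G\<^esub>)\<rparr>"

definition semidirect_topology ::
    "('a, 'b) monoid_scheme \<Rightarrow> 'a topology \<Rightarrow> ('a \<Rightarrow> 'a) set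
       \<Rightarrow> ('a \<times> ('a \<Rightarrow> 'a)) topology" where
  "semidirect_topology G T P = prod_topology T (subtopology (top_auto_topology G T) P)"

end

theory Submission
  imports Defs
begin

text \<open>
  Write \<open>M = G \<times> P\<close> for the semidirect product, \<open>\<tau>\<close> for its product topology and
  \<open>c\<^sub>x\<close> for conjugation by \<open>x\<close>.  An element \<open>(x, f)\<close> of \<open>M\<close> acts on the normal subgroup
  \<open>G \<times> {1}\<close> by conjugation, and this action is the automorphism \<open>c\<^sub>x \<circ> f\<close> of \<open>G\<close>.  Minimality
  is read off from the map \<open>\<phi> : M \<rightarrow> Aut G\<close>, \<open>\<phi>(x, f) = c\<^sub>x \<circ> f\<close>, by comparing two facts.

  First, \<open>\<phi>\<close> is continuous not only for \<open>\<tau>\<close>, but for every coarser Hausdorff group topology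
  \<open>\<sigma>\<close> on \<open>M\<close> (\<open>continuous_map_conj_action_coarser\<close>).  Since \<open>G \<times> {1}\<close> is \<open>\<tau>\<close>-compact, \<open>\<sigma>\<close> and
  \<open>\<tau>\<close> agree on it; hence conjugation is a jointly continuous action of \<open>(M, \<sigma>)\<close> on \<open>G\<close> with its
  original topology, and such an action is the same as a continuous map into the compact-open
  topology.

  Secondly, \<open>\<phi>\<close> is a proper map for \<open>\<tau>\<close> (\<open>proper_map_conj_action\<close>).  The shear
  \<open>(x, f) \<mapsto> (x, c\<^sub>x \<circ> f)\<close> is a self-homeomorphism of \<open>G \<times> Aut G\<close>, the second projection is proper
  because \<open>G\<close> is compact, and \<open>G \<times> P\<close> is closed in \<open>G \<times> Aut G\<close> because \<open>P\<close> is closed in \<open>Aut G\<close>.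

  Now \<open>\<phi>\<close>, as a map on \<open>(M, \<tau>)\<close>, factors as the continuous identity \<open>(M, \<tau>) \<rightarrow> (M, \<sigma>)\<close> followed
  by \<open>\<phi>\<close> on \<open>(M, \<sigma>)\<close>.  A continuous first factor of a proper map through a Hausdorff space is
  proper when the second factor is continuous.  So the identity \<open>(M, \<tau>) \<rightarrow> (M, \<sigma>)\<close> is a closed map,
  that is \<open>\<sigma> = \<tau>\<close>.

  It also has to be shown that \<open>M\<close> is a Hausdorff topological group at all.  This rests on the
  continuity of evaluation, composition and inversion for the compact-open topology on \<open>Aut G\<close>.
\<close>

section \<open>The compact-open topology and proper projections\<close>

lemma topspace_compact_open_topology:
  "topspace (compact_open_topology X Y) = {f \<in> extensional (topspace X). continuous_map X Y f}"
proof
  show "topspace (compact_open_topology X Y) \<subseteq> {f \<in> extensional (topspace X). continuous_map X Y f}"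
    by (auto simp: compact_open_topology_def)
next
  have "{f \<in> extensional (topspace X). continuous_map X Y f \<and> f ` {} \<subseteq> {}} \<in>
      {{f \<in> extensional (topspace X). continuous_map X Y f \<and> f ` K \<subseteq> U} | K U.
        compactin X K \<and> openin Y U}"
    by (rule CollectI, rule exI[of _ "{}"], rule exI[of _ "{}"]) simp
  then show "{f \<in> extensional (topspace X). continuous_map X Y f} \<subseteq> topspace (compact_open_topology X Y)"
    unfolding compact_open_topology_def topology_generated_by_topspace by blast
qed

lemma openin_compact_open_subbasic:
  assumes "compactin X K" "openin Y U"
  shows "openin (compact_open_topology X Y)
           {f \<in> extensional (topspace X). continuous_map X Y f \<and> f ` K \<subseteq> U}"
  unfolding compact_open_topology_def
  by (rule topology_generated_by_Basis) (use assms in blast)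

lemma continuous_map_into_compact_open_subbasic:
  assumes "\<And>z. z \<in> topspace Z \<Longrightarrow> \<Phi> z \<in> extensional (topspace X) \<and> continuous_map X Y (\<Phi> z)"
    and "\<And>K U. \<lbrakk>compactin X K; openin Y U\<rbrakk> \<Longrightarrow> openin Z {z \<in> topspace Z. \<Phi> z ` K \<subseteq> U}"
  shows "continuous_map Z (compact_open_topology X Y) \<Phi>"
  unfolding compact_open_topology_def
proof (rule continuous_on_generated_topo)
  fix W
  assume "W \<in> {{f \<in> extensional (topspace X). continuous_map X Y f \<and> f ` K \<subseteq> U} | K U.
        compactin X K \<and> openin Y U}"
  then obtain K U where W: "W = {f \<in> extensional (topspace X). continuous_map X Y f \<and> f ` K \<subseteq> U}"
    and KU: "compactin X K" "openin Y U" by blast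
  have "\<Phi> -` W \<inter> topspace Z = {z \<in> topspace Z. \<Phi> z ` K \<subseteq> U}"
    using assms(1) by (auto simp: W)
  then show "openin Z (\<Phi> -` W \<inter> topspace Z)"
    using assms(2)[OF KU] by simp
next
  have "\<Phi> ` topspace Z \<subseteq> topspace (compact_open_topology X Y)"
    using assms(1) by (auto simp: topspace_compact_open_topology)
  then show "\<Phi> ` topspace Z \<subseteq> \<Union> {{f \<in> extensional (topspace X). continuous_map X Y f \<and> f ` K \<subseteq> U} | K U.
        compactin X K \<and> openin Y U}"
    unfolding compact_open_topology_def topology_generated_by_topspace .
qed

text \<open>
  Half of the exponential law: a jointly continuous map \<open>Z \<times> X \<rightarrow> Y\<close> curries to a continuous map
  into the function space.  The tube lemma turns \<open>\<Phi> z ` K \<subseteq> U\<close> into a condition that persists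
  near \<open>z\<close>.
\<close>

lemma continuous_map_into_compact_open:
  assumes ext: "\<And>z. z \<in> topspace Z \<Longrightarrow> \<Phi> z \<in> extensional (topspace X)"
    and cont: "continuous_map (prod_topology Z X) Y (\<lambda>p. \<Phi> (fst p) (snd p))"
  shows "continuous_map Z (compact_open_topology X Y) \<Phi>"
proof (rule continuous_map_into_compact_open_subbasic)
  fix z assume z: "z \<in> topspace Z"
  have "continuous_map X (prod_topology Z X) (\<lambda>x. (z, x))"
    using z by (intro continuous_map_pairedI) auto
  from continuous_map_compose[OF this cont] have "continuous_map X Y (\<Phi> z)"
    by (simp add: o_def)
  with ext z show "\<Phi> z \<in> extensional (topspace X) \<and> continuous_map X Y (\<Phi> z)" by blast
next
  fix K U assume K: "compactin X K" and U: "openin Y U"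
  define W where "W = {p \<in> topspace (prod_topology Z X). \<Phi> (fst p) (snd p) \<in> U}"
  have W: "openin (prod_topology Z X) W"
    unfolding W_def by (rule openin_continuous_map_preimage[OF cont U])
  show "openin Z {z \<in> topspace Z. \<Phi> z ` K \<subseteq> U}"
  proof (subst openin_subopen, intro ballI)
    fix z assume "z \<in> {z \<in> topspace Z. \<Phi> z ` K \<subseteq> U}"
    then have z: "z \<in> topspace Z" and "{z} \<times> K \<subseteq> W"
      using compactin_subset_topspace[OF K] by (auto simp: W_def)
    from tube_lemma_right[OF W K this] obtain A B where
      A: "openin Z A" "z \<in> A" and "K \<subseteq> B" "A \<times> B \<subseteq> W" by blast
    then have "A \<subseteq> {z \<in> topspace Z. \<Phi> z ` K \<subseteq> U}"
      using openin_subset[OF A(1)] by (fastforce simp: W_def)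
    with A show "\<exists>A. openin Z A \<and> z \<in> A \<and> A \<subseteq> {z \<in> topspace Z. \<Phi> z ` K \<subseteq> U}" by blast
  qed
qed

text \<open>
  The other half: when a point has a neighbourhood base of compact sets \<open>K\<close>, the subbasic set
  given by \<open>f ` K \<subseteq> U\<close> controls the value of \<open>f\<close> on a whole neighbourhood of the point.
\<close>

lemma continuous_map_compact_open_eval:
  assumes "locally_compact_space X" "Hausdorff_space X \<or> regular_space X"
  shows "continuous_map (prod_topology (compact_open_topology X Y) X) Y (\<lambda>p. fst p (snd p))"
proof -
  let ?C = "compact_open_topology X Y"
  have nb: "neighbourhood_base_of (compactin X) X"
    using assms locally_compact_space_neighbourhood_base by blast
  have "openin (prod_topology ?C X) {p \<in> topspace (prod_topology ?C X). fst p (snd p) \<in> U}"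
    if U: "openin Y U" for U
  proof (subst openin_subopen, intro ballI)
    fix p assume "p \<in> {p \<in> topspace (prod_topology ?C X). fst p (snd p) \<in> U}"
    then obtain f x where p: "p = (f, x)" and f: "f \<in> extensional (topspace X)" "continuous_map X Y f"
      and x: "x \<in> topspace X" "f x \<in> U"
      by (auto simp: topspace_compact_open_topology)
    have "openin X {x \<in> topspace X. f x \<in> U}"
      by (rule openin_continuous_map_preimage[OF f(2) U])
    with nb x obtain A K where A: "openin X A" "x \<in> A" and K: "compactin X K" "A \<subseteq> K"
      "K \<subseteq> {x \<in> topspace X. f x \<in> U}"
      unfolding neighbourhood_base_of by (metis (no_types, lifting) mem_Collect_eq)
    define B where "B = {f \<in> extensional (topspace X). continuous_map X Y f \<and> f ` K \<subseteq> U}"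
    have B: "openin ?C B"
      unfolding B_def by (rule openin_compact_open_subbasic[OF K(1) U])
    have "openin (prod_topology ?C X) (B \<times> A)" "p \<in> B \<times> A"
      using A B K f by (auto simp: openin_prod_Times_iff p B_def)
    moreover have "B \<times> A \<subseteq> {p \<in> topspace (prod_topology ?C X). fst p (snd p) \<in> U}"
      using K openin_subset[OF A(1)] openin_subset[OF B] by (fastforce simp: B_def)
    ultimately show "\<exists>A. openin (prod_topology ?C X) A \<and> p \<in> A
        \<and> A \<subseteq> {p \<in> topspace (prod_topology ?C X). fst p (snd p) \<in> U}" by blast
  qed
  then show ?thesis
    unfolding continuous_map_def
    by (auto simp: topspace_compact_open_topology continuous_map_def Pi_iff)
qed

lemma Hausdorff_space_compact_open:
  assumes "Hausdorff_space Y"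
  shows "Hausdorff_space (compact_open_topology X Y)"
  unfolding Hausdorff_space_def
proof (intro allI impI)
  fix f g
  assume "f \<in> topspace (compact_open_topology X Y) \<and> g \<in> topspace (compact_open_topology X Y) \<and> f \<noteq> g"
  then have f: "f \<in> extensional (topspace X)" "continuous_map X Y f"
    and g: "g \<in> extensional (topspace X)" "continuous_map X Y g" and "f \<noteq> g"
    by (auto simp: topspace_compact_open_topology)
  then obtain x where x: "x \<in> topspace X" "f x \<noteq> g x"
    by (meson extensionalityI)
  moreover have "f x \<in> topspace Y" "g x \<in> topspace Y"
    using x(1) f(2) g(2) by (auto simp: continuous_map_def)
  ultimately obtain U V where UV: "openin Y U" "openin Y V" "f x \<in> U" "g x \<in> V" "disjnt U V"
    using assms unfolding Hausdorff_space_def by blast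
  let ?N = "\<lambda>U. {f \<in> extensional (topspace X). continuous_map X Y f \<and> f ` {x} \<subseteq> U}"
  have "openin (compact_open_topology X Y) (?N U)" "openin (compact_open_topology X Y) (?N V)"
    using x UV by (intro openin_compact_open_subbasic; simp)+
  moreover have "f \<in> ?N U" "g \<in> ?N V" "disjnt (?N U) (?N V)"
    using f g UV by (auto simp: disjnt_iff)
  ultimately show "\<exists>U V. openin (compact_open_topology X Y) U \<and> openin (compact_open_topology X Y) V
      \<and> f \<in> U \<and> g \<in> V \<and> disjnt U V" by blast
qed

lemma continuous_map_on_fst: "continuous_map Z X f \<Longrightarrow> continuous_map (prod_topology Z Y) X (\<lambda>p. f (fst p))"
  using continuous_map_compose[OF continuous_map_fst] by (simp add: o_def)

lemma proper_map_snd_compact: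
  assumes "compact_space X"
  shows "proper_map (prod_topology X Y) Y snd"
  unfolding proper_map_def
proof (intro conjI ballI)
  show "closed_map (prod_topology X Y) Y snd" by (rule closed_map_snd[OF assms])
  fix y assume "y \<in> topspace Y"
  then have "{p \<in> topspace (prod_topology X Y). snd p = y} = topspace X \<times> {y}" by auto
  then show "compactin (prod_topology X Y) {p \<in> topspace (prod_topology X Y). snd p = y}"
    using assms \<open>y \<in> topspace Y\<close> by (simp add: compactin_Times compact_space_def)
qed

section \<open>Topological automorphisms form a group\<close>

locale compact_topological_group = hausdorff_topological_group +
  assumes compact: "compact_space T"
begin

abbreviation "Aut \<equiv> top_auto_group G T"
abbreviation "AutT \<equiv> top_auto_topology G T"

lemma carrier_Aut: "carrier Aut = {f \<in> auto G. homeomorphic_map T T f}"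
  by (simp add: top_auto_group_def)

lemma AutD:
  assumes "f \<in> carrier Aut"
  shows "f \<in> Bij (carrier G)" "f \<in> extensional (carrier G)" "f \<in> hom G G"
    "continuous_map T T f" "bij_betw f (carrier G) (carrier G)" "homeomorphic_map T T f"
  using assms by (auto simp: carrier_Aut auto_def Bij_def homeomorphic_imp_continuous_map)

lemma Aut_closed: "\<lbrakk>f \<in> carrier Aut; x \<in> carrier G\<rbrakk> \<Longrightarrow> f x \<in> carrier G"
  using AutD(3)[of f] by (auto simp: hom_def Pi_iff)

lemma Aut_mult: "\<lbrakk>f \<in> carrier Aut; x \<in> carrier G; y \<in> carrier G\<rbrakk> \<Longrightarrow> f (x \<otimes> y) = f x \<otimes> f y"
  using AutD(3) by (simp add: hom_mult)

lemma mult_AutoGroup: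
  "\<lbrakk>f \<in> carrier Aut; g \<in> carrier Aut\<rbrakk> \<Longrightarrow> f \<otimes>\<^bsub>AutoGroup G\<^esub> g = compose (carrier G) f g"
  by (simp add: AutoGroup_def BijGroup_def AutD)

lemma mult_Aut: "mult Aut = mult (AutoGroup G)" and one_Aut: "one Aut = one (AutoGroup G)"
  by (simp_all add: top_auto_group_def)

lemma one_Aut_eq: "\<one>\<^bsub>Aut\<^esub> = (\<lambda>x\<in>carrier G. x)"
  by (simp add: one_Aut AutoGroup_def BijGroup_def)

text \<open>
  The carrier is shown to be a subgroup of the group of all bijections, and not just of
  \<^term>\<open>AutoGroup G\<close>, because inverses there are known explicitly.
\<close>

lemma subgroup_Aut: "subgroup (carrier Aut) (BijGroup (carrier G))"
proof -
  interpret A: subgroup "auto G" "BijGroup (carrier G)" by (rule subgroup_auto)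
  have mult: "f \<otimes>\<^bsub>BijGroup (carrier G)\<^esub> g = compose (carrier G) f g"
    if "f \<in> auto G" "g \<in> auto G" for f g
    using that by (simp add: BijGroup_def auto_def)
  show ?thesis
  proof
    show "carrier Aut \<subseteq> carrier (BijGroup (carrier G))"
      using A.subset by (auto simp: carrier_Aut)
    show "f \<otimes>\<^bsub>BijGroup (carrier G)\<^esub> g \<in> carrier Aut"
      if f: "f \<in> carrier Aut" and g: "g \<in> carrier Aut" for f g
    proof -
      have "homeomorphic_map T T (compose (carrier G) f g)"
        by (rule homeomorphic_map_eq[OF homeomorphic_map_compose[OF AutD(6)[OF g] AutD(6)[OF f]]])
          (simp add: topspace_eq_carrier compose_eq)
      then show ?thesis
        using f g A.m_closed[of f g] by (auto simp: carrier_Aut mult)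
    qed
    show "\<one>\<^bsub>BijGroup (carrier G)\<^esub> \<in> carrier Aut"
    proof -
      have "homeomorphic_map T T (\<lambda>x\<in>carrier G. x)"
        by (rule homeomorphic_map_eq[OF homeomorphic_map_id[THEN iffD2, OF refl]]) (simp add: topspace_eq_carrier)
      then show ?thesis
        using A.one_closed by (simp add: carrier_Aut BijGroup_def)
    qed
    show "inv\<^bsub>BijGroup (carrier G)\<^esub> f \<in> carrier Aut" if f: "f \<in> carrier Aut" for f
    proof -
      obtain g where g: "homeomorphic_maps T T f g"
        using AutD(6)[OF f] homeomorphic_map_maps by blast
      have "homeomorphic_map T T g"
        using g homeomorphic_maps_map by blast
      moreover have "g x = (\<lambda>x\<in>carrier G. inv_into (carrier G) f x) x" if "x \<in> topspace T" for x
      proof -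
        have "g x \<in> carrier G" "f (g x) = x"
          using g that by (auto simp: homeomorphic_maps_def continuous_map_def topspace_eq_carrier)
        then show ?thesis
          using that AutD(5)[OF f] by (metis bij_betw_def inv_into_f_f restrict_apply' topspace_eq_carrier)
      qed
      ultimately have "homeomorphic_map T T (\<lambda>x\<in>carrier G. inv_into (carrier G) f x)"
        by (rule homeomorphic_map_eq)
      then show ?thesis
        using f A.m_inv_closed[of f] by (simp add: carrier_Aut inv_BijGroup auto_def)
    qed
  qed
qed

lemma Aut_eq: "Aut = BijGroup (carrier G) \<lparr>carrier := carrier Aut\<rparr>"
  by (simp add: top_auto_group_def AutoGroup_def)

lemma group_Aut: "group Aut"
  by (subst Aut_eq) (rule subgroup.subgroup_is_group[OF subgroup_Aut group_BijGroup])

sublocale Aut: group Aut by (rule group_Aut)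

lemma mult_Aut_apply:
  "\<lbrakk>f \<in> carrier Aut; g \<in> carrier Aut; x \<in> carrier G\<rbrakk> \<Longrightarrow> (f \<otimes>\<^bsub>Aut\<^esub> g) x = f (g x)"
  by (simp add: mult_Aut mult_AutoGroup compose_eq)

lemma Aut_eqI:
  assumes "f \<in> carrier Aut" "g \<in> carrier Aut" "\<And>x. x \<in> carrier G \<Longrightarrow> f x = g x"
  shows "f = g"
  using assms AutD(2) by (meson extensionalityI)

lemma inv_Aut_apply:
  assumes "f \<in> carrier Aut" "x \<in> carrier G"
  shows "f ((inv\<^bsub>Aut\<^esub> f) x) = x" "(inv\<^bsub>Aut\<^esub> f) (f x) = x"
  using mult_Aut_apply[of f "inv\<^bsub>Aut\<^esub> f" x] mult_Aut_apply[of "inv\<^bsub>Aut\<^esub> f" f x] assms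
  by (simp_all add: one_Aut_eq)

text \<open>Restricted to the carrier, since the elements of \<^term>\<open>Aut\<close> are extensional.\<close>

definition inner_aut :: "'a \<Rightarrow> 'a \<Rightarrow> 'a" where
  "inner_aut x = (\<lambda>g\<in>carrier G. x \<otimes> g \<otimes> inv x)"

lemma continuous_map_mult:
  assumes "continuous_map Z T f" "continuous_map Z T g"
  shows "continuous_map Z T (\<lambda>z. f z \<otimes> g z)"
  using continuous_map_compose[OF continuous_map_pairedI[OF assms] continuous_mult]
  by (simp add: o_def)

lemma continuous_map_minv:
  assumes "continuous_map Z T f"
  shows "continuous_map Z T (\<lambda>z. inv (f z))"
  using continuous_map_compose[OF assms continuous_inv] by (simp add: o_def)

lemma inner_inner:
  assumes "x \<in> carrier G" "y \<in> carrier G" "g \<in> carrier G"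
  shows "inner_aut x (inner_aut y g) = inner_aut (x \<otimes> y) g"
  using assms by (simp add: inner_aut_def m_assoc inv_mult_group)

lemma inner_one: "g \<in> carrier G \<Longrightarrow> inner_aut \<one> g = g"
  by (simp add: inner_aut_def)

lemma inner_closed: "\<lbrakk>x \<in> carrier G; g \<in> carrier G\<rbrakk> \<Longrightarrow> inner_aut x g \<in> carrier G"
  by (simp add: inner_aut_def)

lemma inner_in_Aut:
  assumes x: "x \<in> carrier G"
  shows "inner_aut x \<in> carrier Aut"
proof -
  have cancel: "inner_aut (inv x) (inner_aut x g) = g" "inner_aut x (inner_aut (inv x) g) = g" if "g \<in> carrier G" for g
    using x that by (simp_all add: inner_inner inner_one)
  have "bij_betw (inner_aut x) (carrier G) (carrier G)"
    by (rule bij_betw_byWitness[where f' = "inner_aut (inv x)"]) (use x cancel inner_closed in auto)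
  moreover have "inner_aut x \<in> hom G G"
  proof (rule homI)
    fix g h assume gh: "g \<in> carrier G" "h \<in> carrier G"
    have "x \<otimes> g \<otimes> inv x \<otimes> (x \<otimes> h \<otimes> inv x) = x \<otimes> g \<otimes> (inv x \<otimes> x) \<otimes> h \<otimes> inv x"
      using x gh by (simp only: m_assoc inv_closed m_closed)
    also have "\<dots> = x \<otimes> (g \<otimes> h) \<otimes> inv x"
      using x gh by (simp add: m_assoc)
    finally show "inner_aut x (g \<otimes> h) = inner_aut x g \<otimes> inner_aut x h"
      using gh by (simp add: inner_aut_def)
  qed (use x inner_closed in auto)
  moreover have cont: "continuous_map T T (inner_aut y)" if "y \<in> carrier G" for y
  proof -
    have "continuous_map T T (\<lambda>g. y \<otimes> g \<otimes> inv y)"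
      using that by (intro continuous_map_mult) (auto simp: topspace_eq_carrier)
    then show ?thesis
      by (rule continuous_map_eq) (simp add: inner_aut_def topspace_eq_carrier)
  qed
  have "homeomorphic_maps T T (inner_aut x) (inner_aut (inv x))"
    unfolding homeomorphic_maps_def using x cont cancel by (simp add: topspace_eq_carrier)
  then have "homeomorphic_map T T (inner_aut x)" by (rule homeomorphic_maps_imp_map)
  ultimately show ?thesis
    by (simp add: carrier_Aut auto_def Bij_def inner_aut_def)
qed

lemma inner_mult:
  assumes "x \<in> carrier G" "y \<in> carrier G"
  shows "inner_aut (x \<otimes> y) = inner_aut x \<otimes>\<^bsub>Aut\<^esub> inner_aut y"
  by (rule Aut_eqI) (use assms in \<open>simp_all add: inner_in_Aut mult_Aut_apply inner_inner\<close>)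


section \<open>Continuity of the group operations\<close>

lemma topspace_AutT: "topspace AutT = carrier Aut"
  using AutD(2,4) by (auto simp: top_auto_topology_def topspace_compact_open_topology topspace_eq_carrier)

lemma Hausdorff_AutT: "Hausdorff_space AutT"
  by (simp add: top_auto_topology_def Hausdorff_space_subtopology Hausdorff_space_compact_open hausdorff)

lemma continuous_map_into_AutT:
  assumes "\<And>z. z \<in> topspace Z \<Longrightarrow> \<Phi> z \<in> carrier Aut"
    and "continuous_map (prod_topology Z T) T (\<lambda>p. \<Phi> (fst p) (snd p))"
  shows "continuous_map Z AutT \<Phi>"
  unfolding top_auto_topology_def
  by (intro continuous_map_into_subtopology continuous_map_into_compact_open)
    (use assms AutD(2) in \<open>auto simp: topspace_eq_carrier\<close>)

text \<open>
  Compactness of \<open>G\<close> enters through local compactness: it makes the action of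
  \<^term>\<open>Aut\<close> on \<open>G\<close> jointly continuous.
\<close>

lemma continuous_map_apply:
  assumes f: "continuous_map Z AutT f" and g: "continuous_map Z T g"
  shows "continuous_map Z T (\<lambda>z. f z (g z))"
proof -
  have "continuous_map Z (compact_open_topology T T) f"
    using f unfolding top_auto_topology_def by (rule continuous_map_into_fulltopology)
  from continuous_map_compose[OF continuous_map_pairedI[OF this g] continuous_map_compact_open_eval]
  show ?thesis
    by (simp add: o_def hausdorff compact compact_imp_locally_compact_space)
qed

lemma continuous_map_in_Aut: "\<lbrakk>continuous_map Z AutT f; z \<in> topspace Z\<rbrakk> \<Longrightarrow> f z \<in> carrier Aut"
  by (auto simp: continuous_map_def topspace_AutT)

lemma continuous_map_in_G: "\<lbrakk>continuous_map Z T f; z \<in> topspace Z\<rbrakk> \<Longrightarrow> f z \<in> carrier G"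
  by (auto simp: continuous_map_def topspace_eq_carrier)

lemma continuous_map_AutT_mult:
  assumes f: "continuous_map Z AutT f" and g: "continuous_map Z AutT g"
  shows "continuous_map Z AutT (\<lambda>z. f z \<otimes>\<^bsub>Aut\<^esub> g z)"
proof (rule continuous_map_into_AutT)
  show "f z \<otimes>\<^bsub>Aut\<^esub> g z \<in> carrier Aut" if "z \<in> topspace Z" for z
    using that f g by (simp add: continuous_map_in_Aut)
  have "continuous_map (prod_topology Z T) T (\<lambda>p. f (fst p) (g (fst p) (snd p)))"
    using continuous_map_apply[where f = "\<lambda>p. f (fst p)", OF continuous_map_on_fst[OF f]
        continuous_map_apply[where f = "\<lambda>p. g (fst p)", OF continuous_map_on_fst[OF g] continuous_map_snd]] .
  then show "continuous_map (prod_topology Z T) T (\<lambda>p. (f (fst p) \<otimes>\<^bsub>Aut\<^esub> g (fst p)) (snd p))"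
    by (rule continuous_map_eq)
      (use f g in \<open>auto simp: mult_Aut_apply continuous_map_in_Aut topspace_eq_carrier\<close>)
qed

text \<open>
  For a bijection \<open>f\<close>, the inverse maps \<open>K\<close> into \<open>U\<close> exactly when \<open>f\<close> maps the complement of \<open>U\<close>
  into the complement of \<open>K\<close>.  In a compact Hausdorff space complements exchange open sets and
  compact sets, so inversion permutes the subbasic sets.
\<close>

lemma continuous_map_AutT_inv: "continuous_map AutT AutT (\<lambda>f. inv\<^bsub>Aut\<^esub> f)"
proof -
  have "continuous_map AutT (compact_open_topology T T) (\<lambda>f. inv\<^bsub>Aut\<^esub> f)"
  proof (rule continuous_map_into_compact_open_subbasic)
    show "inv\<^bsub>Aut\<^esub> f \<in> extensional (topspace T) \<and> continuous_map T T (inv\<^bsub>Aut\<^esub> f)"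
      if "f \<in> topspace AutT" for f
      using that AutD(2,4)[of "inv\<^bsub>Aut\<^esub> f"] by (simp add: topspace_AutT topspace_eq_carrier)
  next
    fix K U assume K: "compactin T K" and U: "openin T U"
    have KG: "K \<subseteq> carrier G"
      using compactin_subset_topspace[OF K] by (simp add: topspace_eq_carrier)
    have K': "openin T (carrier G - K)"
      using compactin_imp_closedin[OF hausdorff K] by (simp add: closedin_def topspace_eq_carrier)
    have U': "compactin T (carrier G - U)"
      using closedin_compact_space[OF compact] U closedin_diff[OF closedin_topspace U]
      by (simp add: topspace_eq_carrier)
    have "{f \<in> topspace AutT. (inv\<^bsub>Aut\<^esub> f) ` K \<subseteq> U} =
        {f \<in> extensional (topspace T). continuous_map T T f \<and> f ` (carrier G - U) \<subseteq> carrier G - K}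
          \<inter> carrier Aut" (is "?A = ?B")
    proof
      show "?A \<subseteq> ?B"
      proof
        fix f assume "f \<in> ?A"
        then have f: "f \<in> carrier Aut" and sub: "(inv\<^bsub>Aut\<^esub> f) ` K \<subseteq> U"
          by (auto simp: topspace_AutT)
        have "f y \<in> carrier G - K" if "y \<in> carrier G - U" for y
          using that sub inv_Aut_apply(2)[OF f, of y] Aut_closed[OF f] by force
        then show "f \<in> ?B"
          using f AutD(2,4) by (auto simp: topspace_eq_carrier)
      qed
      show "?B \<subseteq> ?A"
      proof
        fix f assume "f \<in> ?B"
        then have f: "f \<in> carrier Aut" and sub: "f ` (carrier G - U) \<subseteq> carrier G - K" by auto
        have "(inv\<^bsub>Aut\<^esub> f) y \<in> U" if "y \<in> K" for y
          using that sub KG inv_Aut_apply(1)[OF f, of y] Aut_closed[OF Aut.inv_closed[OF f], of y] by force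
        then show "f \<in> ?A"
          using f by (auto simp: topspace_AutT)
      qed
    qed
    then show "openin AutT {f \<in> topspace AutT. (inv\<^bsub>Aut\<^esub> f) ` K \<subseteq> U}"
      using openin_compact_open_subbasic[OF U' K']
      by (simp add: top_auto_topology_def openin_subtopology_Int)
  qed
  then show ?thesis
    unfolding top_auto_topology_def[of G T]
    by (intro continuous_map_into_subtopology)
      (auto simp: continuous_map_from_subtopology topspace_AutT simp flip: top_auto_topology_def)
qed

lemma continuous_map_inner_aut:
  assumes f: "continuous_map Z T f"
  shows "continuous_map Z AutT (\<lambda>z. inner_aut (f z))"
proof (rule continuous_map_into_AutT)
  show "inner_aut (f z) \<in> carrier Aut" if "z \<in> topspace Z" for z
    using that f by (simp add: continuous_map_in_G inner_in_Aut)
  have "continuous_map (prod_topology Z T) T (\<lambda>p. f (fst p) \<otimes> snd p \<otimes> inv f (fst p))"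
    by (intro continuous_map_mult continuous_map_minv continuous_map_on_fst[OF f] continuous_map_snd)
  then show "continuous_map (prod_topology Z T) T (\<lambda>p. inner_aut (f (fst p)) (snd p))"
    by (rule continuous_map_eq) (auto simp: inner_aut_def topspace_eq_carrier)
qed

text \<open>
  This map is the second projection after the shear \<open>(x, f) \<mapsto> (x, c\<^sub>x \<circ> f)\<close> of
  \<open>G \<times> Aut G\<close>.  The shear is a homeomorphism and the projection is proper since \<open>G\<close> is compact.
\<close>

lemma proper_map_inner_aut_mult:
  "proper_map (prod_topology T AutT) AutT (\<lambda>(x, f). inner_aut x \<otimes>\<^bsub>Aut\<^esub> f)"
proof -
  have fst: "continuous_map (prod_topology T AutT) T fst"
    and snd: "continuous_map (prod_topology T AutT) AutT snd"
    by (rule continuous_map_fst continuous_map_snd)+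
  let ?shear = "\<lambda>p. (fst p, inner_aut (fst p) \<otimes>\<^bsub>Aut\<^esub> snd p)"
  let ?unshear = "\<lambda>p. (fst p, inner_aut (inv (fst p)) \<otimes>\<^bsub>Aut\<^esub> snd p)"
  have cancel: "inner_aut x \<otimes>\<^bsub>Aut\<^esub> (inner_aut (inv x) \<otimes>\<^bsub>Aut\<^esub> f) = f"
      "inner_aut (inv x) \<otimes>\<^bsub>Aut\<^esub> (inner_aut x \<otimes>\<^bsub>Aut\<^esub> f) = f"
    if "x \<in> carrier G" "f \<in> carrier Aut" for x f
  proof -
    have "inner_aut \<one> = \<one>\<^bsub>Aut\<^esub>"
      using inner_in_Aut[OF one_closed] inner_mult[OF one_closed one_closed] Aut.l_cancel_one by force
    then show "inner_aut x \<otimes>\<^bsub>Aut\<^esub> (inner_aut (inv x) \<otimes>\<^bsub>Aut\<^esub> f) = f"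
      "inner_aut (inv x) \<otimes>\<^bsub>Aut\<^esub> (inner_aut x \<otimes>\<^bsub>Aut\<^esub> f) = f"
      using that inner_mult[of x "inv x"] inner_mult[of "inv x" x]
      by (simp_all add: inner_in_Aut flip: Aut.m_assoc)
  qed
  have "homeomorphic_maps (prod_topology T AutT) (prod_topology T AutT) ?shear ?unshear"
    unfolding homeomorphic_maps_def
    by (intro conjI continuous_map_pairedI continuous_map_AutT_mult continuous_map_inner_aut
        continuous_map_minv fst snd)
      (auto simp: topspace_AutT topspace_eq_carrier cancel)
  then have "proper_map (prod_topology T AutT) (prod_topology T AutT) ?shear"
    by (intro homeomorphic_imp_proper_map homeomorphic_maps_imp_map)
  from proper_map_compose[OF this proper_map_snd_compact[OF compact]]
  show ?thesis by (simp add: o_def case_prod_unfold)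
qed

end

section \<open>Semidirect products\<close>

locale compact_semidirect_product = compact_topological_group +
  fixes P
  assumes subgroup_P: "subgroup P (top_auto_group G T)"
begin

abbreviation "M \<equiv> semidirect_product G P"
abbreviation "MT \<equiv> semidirect_topology G T P"

lemma P_Aut: "f \<in> P \<Longrightarrow> f \<in> carrier Aut"
  using subgroup.mem_carrier[OF subgroup_P] .

lemma carrier_M: "carrier M = carrier G \<times> P"
  by (simp add: semidirect_product_def)

lemma mult_M: "(x, f) \<otimes>\<^bsub>M\<^esub> (y, g) = (x \<otimes> f y, f \<otimes>\<^bsub>Aut\<^esub> g)"
  by (simp add: semidirect_product_def mult_Aut)

lemma one_M: "\<one>\<^bsub>M\<^esub> = (\<one>, \<one>\<^bsub>Aut\<^esub>)"
  by (simp add: semidirect_product_def one_Aut)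

lemma one_Aut_apply: "x \<in> carrier G \<Longrightarrow> \<one>\<^bsub>Aut\<^esub> x = x"
  by (simp add: one_Aut_eq)

lemma Aut_one: "f \<in> carrier Aut \<Longrightarrow> f \<one> = \<one>"
  using Aut_mult[of f \<one> \<one>] Aut_closed[of f \<one>] r_cancel_one by force

lemma left_inverse_M:
  assumes "x \<in> carrier G" "f \<in> P"
  shows "((inv\<^bsub>Aut\<^esub> f) (inv x), inv\<^bsub>Aut\<^esub> f) \<otimes>\<^bsub>M\<^esub> (x, f) = \<one>\<^bsub>M\<^esub>"
proof -
  have f: "f \<in> carrier Aut" "inv\<^bsub>Aut\<^esub> f \<in> carrier Aut" using assms P_Aut by auto
  have "(inv\<^bsub>Aut\<^esub> f) (inv x) \<otimes> (inv\<^bsub>Aut\<^esub> f) x = (inv\<^bsub>Aut\<^esub> f) (inv x \<otimes> x)"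
    using assms f Aut_mult[of "inv\<^bsub>Aut\<^esub> f" "inv x" x] by simp
  then show ?thesis
    using assms f by (simp add: mult_M one_M Aut_one)
qed

lemma group_M: "group M"
proof (rule groupI)
  show "p \<otimes>\<^bsub>M\<^esub> q \<in> carrier M" if "p \<in> carrier M" "q \<in> carrier M" for p q
    using that subgroup.m_closed[OF subgroup_P] Aut_closed[OF P_Aut]
    by (cases p; cases q) (simp add: carrier_M mult_M)
  show "\<one>\<^bsub>M\<^esub> \<in> carrier M"
    using subgroup.one_closed[OF subgroup_P] by (simp add: carrier_M one_M)
  show "p \<otimes>\<^bsub>M\<^esub> q \<otimes>\<^bsub>M\<^esub> r = p \<otimes>\<^bsub>M\<^esub> (q \<otimes>\<^bsub>M\<^esub> r)"
    if "p \<in> carrier M" "q \<in> carrier M" "r \<in> carrier M" for p q r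
  proof -
    obtain x f y g z h where p: "p = (x, f)" "q = (y, g)" "r = (z, h)"
      by (cases p; cases q; cases r) blast
    then have "x \<in> carrier G" "y \<in> carrier G" "z \<in> carrier G"
      and fgh: "f \<in> carrier Aut" "g \<in> carrier Aut" "h \<in> carrier Aut"
      using that P_Aut by (auto simp: carrier_M)
    moreover from this have "f y \<in> carrier G" "g z \<in> carrier G" "f (g z) \<in> carrier G"
      by (simp_all only: Aut_closed)
    ultimately show ?thesis
      by (simp add: p mult_M mult_Aut_apply Aut_mult[OF fgh(1)] m_assoc Aut.m_assoc)
  qed
  show "\<one>\<^bsub>M\<^esub> \<otimes>\<^bsub>M\<^esub> p = p" if "p \<in> carrier M" for p
    using that P_Aut by (auto simp: carrier_M mult_M one_M one_Aut_apply)
  show "\<exists>q\<in>carrier M. q \<otimes>\<^bsub>M\<^esub> p = \<one>\<^bsub>M\<^esub>" if "p \<in> carrier M" for p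
  proof -
    obtain x f where p: "p = (x, f)" "x \<in> carrier G" "f \<in> P"
      using \<open>p \<in> carrier M\<close> by (auto simp: carrier_M)
    then have "((inv\<^bsub>Aut\<^esub> f) (inv x), inv\<^bsub>Aut\<^esub> f) \<in> carrier M"
      using subgroup.m_inv_closed[OF subgroup_P] Aut_closed[OF Aut.inv_closed[OF P_Aut]]
      by (simp add: carrier_M)
    then show ?thesis using left_inverse_M p by blast
  qed
qed

sublocale M: group M by (rule group_M)

lemma inv_M:
  assumes "x \<in> carrier G" "f \<in> P"
  shows "inv\<^bsub>M\<^esub> (x, f) = ((inv\<^bsub>Aut\<^esub> f) (inv x), inv\<^bsub>Aut\<^esub> f)"
  by (rule M.inv_equality[OF left_inverse_M[OF assms]])
    (use assms subgroup.m_inv_closed[OF subgroup_P] Aut_closed[OF Aut.inv_closed[OF P_Aut]] in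
      \<open>auto simp: carrier_M\<close>)

lemma topspace_MT: "topspace MT = carrier M"
  using P_Aut by (auto simp: semidirect_topology_def topspace_AutT topspace_eq_carrier carrier_M)

lemma continuous_map_into_MT:
  assumes "continuous_map Z T f" "continuous_map Z AutT g" "\<And>z. z \<in> topspace Z \<Longrightarrow> g z \<in> P"
  shows "continuous_map Z MT (\<lambda>z. (f z, g z))"
  unfolding semidirect_topology_def
  by (intro continuous_map_pairedI continuous_map_into_subtopology) (use assms in auto)

lemma continuous_map_MT_fst: "continuous_map MT T fst"
  unfolding semidirect_topology_def by (rule continuous_map_fst)

lemma continuous_map_MT_snd: "continuous_map MT AutT snd"
  unfolding semidirect_topology_def by (rule continuous_map_into_fulltopology[OF continuous_map_snd])

lemma hausdorff_topological_group_M: "hausdorff_topological_group M MT"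
proof
  show "topspace MT = carrier M" by (rule topspace_MT)
  have cf: "continuous_map Z T (\<lambda>z. fst (h z))" and cs: "continuous_map Z AutT (\<lambda>z. snd (h z))"
    if "continuous_map Z MT h" for Z and h :: "'z \<Rightarrow> 'a \<times> ('a \<Rightarrow> 'a)"
    using continuous_map_compose[OF that continuous_map_MT_fst]
      continuous_map_compose[OF that continuous_map_MT_snd] by (simp_all add: o_def)
  note cont = cf[OF continuous_map_fst] cs[OF continuous_map_fst] cf[OF continuous_map_snd] cs[OF continuous_map_snd]
  have "continuous_map (prod_topology MT MT) MT
     (\<lambda>p. (fst (fst p) \<otimes> (snd (fst p)) (fst (snd p)), snd (fst p) \<otimes>\<^bsub>Aut\<^esub> snd (snd p)))"
    by (intro continuous_map_into_MT continuous_map_mult continuous_map_apply[OF cont(2,3)]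
        continuous_map_AutT_mult cont)
      (use subgroup.m_closed[OF subgroup_P] in \<open>auto simp: topspace_MT carrier_M\<close>)
  then show "continuous_map (prod_topology MT MT) MT (\<lambda>(p, q). p \<otimes>\<^bsub>M\<^esub> q)"
    by (rule continuous_map_eq) (auto simp: mult_M)
  have inv_fst: "continuous_map MT T (\<lambda>p. inv (fst p))"
    by (rule continuous_map_minv[OF continuous_map_MT_fst])
  have inv_snd: "continuous_map MT AutT (\<lambda>p. inv\<^bsub>Aut\<^esub> (snd p))"
    using continuous_map_compose[OF continuous_map_MT_snd continuous_map_AutT_inv] by (simp add: o_def)
  have "continuous_map MT MT (\<lambda>p. ((inv\<^bsub>Aut\<^esub> (snd p)) (inv (fst p)), inv\<^bsub>Aut\<^esub> (snd p)))"
    by (intro continuous_map_into_MT continuous_map_apply[OF inv_snd inv_fst] inv_snd)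
      (use subgroup.m_inv_closed[OF subgroup_P] in \<open>auto simp: topspace_MT carrier_M\<close>)
  then show "continuous_map MT MT (\<lambda>p. inv\<^bsub>M\<^esub> p)"
    by (rule continuous_map_eq) (auto simp: inv_M topspace_MT carrier_M)
  show "Hausdorff_space MT"
    by (simp add: semidirect_topology_def Hausdorff_space_prod_topology hausdorff
        Hausdorff_space_subtopology Hausdorff_AutT)
qed

text \<open>The automorphism of \<open>G\<close> that \<open>m\<close> induces by conjugation on \<open>G \<times> {1}\<close>.\<close>

definition conj_action :: "'a \<times> ('a \<Rightarrow> 'a) \<Rightarrow> 'a \<Rightarrow> 'a" where
  "conj_action = (\<lambda>(x, f). inner_aut x \<otimes>\<^bsub>Aut\<^esub> f)"

lemma conj_action_in_Aut:
  assumes "m \<in> carrier M"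
  shows "conj_action m \<in> carrier Aut"
proof -
  obtain x f where m: "m = (x, f)" "x \<in> carrier G" "f \<in> P"
    using assms by (auto simp: carrier_M)
  then show ?thesis
    using Aut.m_closed[OF inner_in_Aut[OF m(2)] P_Aut[OF m(3)]] by (simp add: conj_action_def)
qed

text \<open>
  This identity expresses \<open>c\<^sub>x \<circ> f\<close> through the group operations of \<open>M\<close> alone, so that it can be
  used with any group topology on \<open>M\<close>.
\<close>

lemma conj_action_apply:
  assumes m: "m \<in> carrier M" and g: "g \<in> carrier G"
  shows "(conj_action m g, \<one>\<^bsub>Aut\<^esub>) = m \<otimes>\<^bsub>M\<^esub> (g, \<one>\<^bsub>Aut\<^esub>) \<otimes>\<^bsub>M\<^esub> inv\<^bsub>M\<^esub> m"
proof -
  obtain x f where mxf: "m = (x, f)" "x \<in> carrier G" "f \<in> P" using m by (auto simp: carrier_M)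
  then have f: "f \<in> carrier Aut" "f g \<in> carrier G" using P_Aut Aut_closed g by auto
  have one: "\<one>\<^bsub>Aut\<^esub> \<in> P" using subgroup.one_closed[OF subgroup_P] .
  have c: "(conj_action m g, \<one>\<^bsub>Aut\<^esub>) \<in> carrier M" "(g, \<one>\<^bsub>Aut\<^esub>) \<in> carrier M"
    using Aut_closed[OF conj_action_in_Aut[OF m] g] g one by (auto simp: carrier_M)
  have "conj_action m g = x \<otimes> f g \<otimes> inv x"
    using mult_Aut_apply[OF inner_in_Aut[OF mxf(2)] f(1) g] f(2)
    by (simp add: conj_action_def mxf(1) inner_aut_def)
  then have "(conj_action m g, \<one>\<^bsub>Aut\<^esub>) \<otimes>\<^bsub>M\<^esub> m = m \<otimes>\<^bsub>M\<^esub> (g, \<one>\<^bsub>Aut\<^esub>)"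
    using mxf f by (simp add: mult_M one_Aut_apply m_assoc)
  then show ?thesis
    using m c by (simp add: M.inv_solve_right)
qed

text \<open>
  Restricting a proper map to a closed subspace keeps it proper; this is where \<open>P\<close> has to be closed.
\<close>

lemma proper_map_conj_action:
  assumes "closedin AutT P"
  shows "proper_map MT AutT conj_action"
proof -
  have MT: "MT = subtopology (prod_topology T AutT) (carrier G \<times> P)"
    by (simp add: semidirect_topology_def prod_topology_subtopology(2) topspace_eq_carrier)
  have "closedin (prod_topology T AutT) (carrier G \<times> P)"
    using assms closedin_topspace[of T] by (simp add: closedin_prod_Times_iff topspace_eq_carrier)
  then have "proper_map MT (prod_topology T AutT) id"
    unfolding MT by (metis closedin_subset proper_map_inclusion closed_Int_compactin)
  from proper_map_compose[OF this proper_map_inner_aut_mult] show ?thesis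
    by (simp add: conj_action_def)
qed

text \<open>
  By the exponential law it is enough that \<open>M\<close> with the coarser topology acts on \<open>G\<close> jointly
  continuously.  Conjugation in \<open>M\<close> certainly has values in \<open>M\<close> that depend continuously on both
  arguments; that they are continuous in the topology of \<open>G\<close> as well is due to the compactness of
  \<open>G\<close>, which makes its inclusion into the Hausdorff space \<open>M\<close> an embedding.
\<close>

lemma continuous_map_conj_action_coarser:
  assumes "hausdorff_topological_group M S" and coarser: "\<And>U. openin S U \<Longrightarrow> openin MT U"
  shows "continuous_map S AutT conj_action"
proof (rule continuous_map_into_AutT)
  interpret S: hausdorff_topological_group M S by fact
  show "conj_action m \<in> carrier Aut" if "m \<in> topspace S" for m
    using that by (simp add: conj_action_in_Aut S.topspace_eq_carrier)
  let ?\<iota> = "\<lambda>g. (g, \<one>\<^bsub>Aut\<^esub>)"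
  have "continuous_map T MT ?\<iota>"
    using subgroup.one_closed[OF subgroup_P]
    by (intro continuous_map_into_MT) (auto simp: topspace_AutT)
  moreover have "continuous_map MT S id"
    using coarser topology_finer_continuous_id[of S MT] by (simp add: S.topspace_eq_carrier topspace_MT)
  ultimately have \<iota>: "continuous_map T S ?\<iota>"
    using continuous_map_compose by fastforce
  have "embedding_map T S ?\<iota>"
    by (rule injective_closed_imp_embedding_map[OF \<iota> continuous_imp_closed_map[OF \<iota> compact S.hausdorff]])
      (simp add: inj_on_def)
  \<comment> \<open>\<open>r\<close> recovers the \<open>G\<close>-component, continuously, from a point of the image of \<open>G\<close> in \<open>S\<close>.\<close>
  then obtain r where r: "homeomorphic_maps T (subtopology S (?\<iota> ` topspace T)) ?\<iota> r"
    unfolding embedding_map_def homeomorphic_map_maps by blast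
  let ?c = "\<lambda>p. fst p \<otimes>\<^bsub>M\<^esub> ?\<iota> (snd p) \<otimes>\<^bsub>M\<^esub> inv\<^bsub>M\<^esub> (fst p)"
  have mult: "continuous_map Z S (\<lambda>z. f z \<otimes>\<^bsub>M\<^esub> g z)"
    if "continuous_map Z S f" "continuous_map Z S g"
    for Z and f g :: "'z \<Rightarrow> 'a \<times> ('a \<Rightarrow> 'a)"
    using continuous_map_compose[OF continuous_map_pairedI[OF that] S.continuous_mult]
    by (simp add: o_def)
  have "continuous_map (prod_topology S T) S (\<lambda>p. ?\<iota> (snd p))"
    using continuous_map_compose[OF continuous_map_snd \<iota>] by (simp add: o_def)
  moreover have "continuous_map (prod_topology S T) S (\<lambda>p. inv\<^bsub>M\<^esub> (fst p))"
    using continuous_map_compose[OF continuous_map_fst S.continuous_inv] by (simp add: o_def)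
  ultimately have "continuous_map (prod_topology S T) S ?c"
    by (intro mult continuous_map_fst)
  moreover have c: "?c p = ?\<iota> (conj_action (fst p) (snd p)) \<and> conj_action (fst p) (snd p) \<in> topspace T"
    if "p \<in> topspace (prod_topology S T)" for p
    using that conj_action_apply[of "fst p" "snd p"] Aut_closed[OF conj_action_in_Aut]
    by (auto simp: S.topspace_eq_carrier topspace_eq_carrier)
  ultimately have "continuous_map (prod_topology S T) (subtopology S (?\<iota> ` topspace T)) ?c"
    by (intro continuous_map_into_subtopology) auto
  then have "continuous_map (prod_topology S T) T (r \<circ> ?c)"
    using r unfolding homeomorphic_maps_def by (blast intro: continuous_map_compose)
  then show "continuous_map (prod_topology S T) T (\<lambda>p. conj_action (fst p) (snd p))"
    by (rule continuous_map_eq) (use c r in \<open>auto simp: homeomorphic_maps_def\<close>)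
qed

lemma coarser_Hausdorff_eq:
  assumes P: "closedin AutT P"
    and S: "hausdorff_topological_group M S" and coarser: "\<And>U. openin S U \<Longrightarrow> openin MT U"
  shows "S = MT"
proof -
  interpret S: hausdorff_topological_group M S by fact
  have top: "topspace S = topspace MT" by (simp add: S.topspace_eq_carrier topspace_MT)
  have "continuous_map MT S id"
    using coarser topology_finer_continuous_id[OF top] by simp
  moreover have "proper_map MT AutT (conj_action \<circ> id)"
    using proper_map_conj_action[OF P] by simp
  ultimately have "proper_map MT S id"
    using proper_map_from_composition_right[OF S.hausdorff] continuous_map_conj_action_coarser[OF S coarser]
    by blast
  then have "closedin S C" if "closedin MT C" for C
    using that unfolding proper_map_def closed_map_def by auto
  then have "openin S U" if "openin MT U" for U
    using that top by (metis openin_closedin_eq)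
  with coarser show ?thesis by (auto simp: topology_eq)
qed

end

section \<open>Minimality\<close>

theorem theorem4p2:
  fixes G :: "('a, 'b) monoid_scheme" and T :: "'a topology" and P :: "('a \<Rightarrow> 'a) set"
  assumes "hausdorff_topological_group G T"
    and "compact_space T"
    and "subgroup P (top_auto_group G T)"
    and "closedin (top_auto_topology G T) P"
  shows "minimal_topological_group (semidirect_product G P) (semidirect_topology G T P)"
proof -
  interpret hausdorff_topological_group G T by fact
  interpret compact_semidirect_product G T P
    by (intro compact_semidirect_product.intro compact_topological_group.intro
        compact_topological_group_axioms.intro compact_semidirect_product_axioms.intro assms)
  show ?thesis
    unfolding minimal_topological_group_def strictly_coarser_def
    using hausdorff_topological_group_M coarser_Hausdorff_eq[OF assms(4)] by blast
qed

end
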